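(* Let $V$ be a vector space and let $$\mathcal J=\begin{pmatrix}-R_D&\pi^\sharp\\0&D\end{pmatrix}:\mathfrak{gl}(V)\oplus V\to\mathfrak{gl}(V)\oplus V$$ be a generalized almost complex structure on the omni-Lie algebra $\mathfrak{ol}(V)$, where $\pi\in\mathrm{Hom}(\wedge^2V,V)$, $D\in\mathfrak{gl}(V)$ satisfy $D^2=-\mathrm{id}_V$ and $\pi(Du,v)=\pi(u,Dv)$ for all $u,v\in V$, and $R_D(A)=A\circ D$ for $A\in\mathfrak{gl}(V)$. Then $\mathcal J$ is a generalized complex structure if and only if (i) $\pi$ defines a Lie algebra structure $[\cdot,\cdot]_\pi$ on $V$, where $[u,v]_\pi=\pi(u,v)$; (ii) $D^2=-\mathrm{id}_V$ and $D[u,v]_\pi=[u,Dv]_\pi$ for all $u,v\in V$. Thus, a generalized complex structure on the omni-Lie algebra $\mathfrak{ol}(V)$ gives rise to a complex Lie algebra structure on $V$.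
   Context: Vector spaces are real and finite-dimensional. The omni-Lie algebra $\mathfrak{ol}(V)$ is $\mathfrak{gl}(V)\oplus V$ with the nondegenerate symmetric $V$-valued pairing $(A+u,B+v)_V=\tfrac12(Av+Bu)$ and the bracket $[\![A+u,B+v]\!]=[A,B]+Av$. A generalized almost complex structure on $\mathfrak{ol}(V)$ is a linear map $\mathcal J:\mathfrak{gl}(V)\oplus V\to\mathfrak{gl}(V)\oplus V$ with $\mathcal J^2=-\mathrm{id}$ and $(\mathcal J(e_1),\mathcal J(e_2))_V=(e_1,e_2)_V$ for all $e_1,e_2$; it is a generalized complex structure if moreover $$[\![\mathcal J(e_1),\mathcal J(e_2)]\!]-[\![e_1,e_2]\!]-\mathcal J\big([\![\mathcal J(e_1),e_2]\!]+[\![e_1,\mathcal J(e_2)]\!]\big)=0\quad\text{for all }e_1,e_2.$$ For $\pi\in\mathrm{Hom}(\wedge^2V,V)$, $\pi^\sharp:V\to\mathfrak{gl}(V)$ is $\pi^\sharp(u)(v)=\pi(u,v)$. The matrix means $\mathcal J(A+u)=\big(-A\circ D+\pi^\sharp(u)\big)+Du$. A complex Lie algebra structure on a real Lie algebra $(V,[\cdot,\cdot])$ is a $D\in\mathfrak{gl}(V)$ with $D^2=-\mathrm{id}_V$ and $D[u,v]=[u,Dv]$ for all $u,v\in V$. *)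

theory Defs
  imports "HOL-Analysis.Analysis"
begin

typedef (overloaded) 'v gl = "{f :: 'v::real_vector \<Rightarrow> 'v. linear f}"
  morphisms gl_app Abs_gl
  by (rule exI[of _ "\<lambda>x. x"]) (simp add: linear_iff)

setup_lifting type_definition_gl

instantiation gl :: (real_vector) real_vector
begin

lift_definition zero_gl :: "'a gl" is "\<lambda>x. 0"
  by (simp add: linear_iff)

lift_definition plus_gl :: "'a gl \<Rightarrow> 'a gl \<Rightarrow> 'a gl" is "\<lambda>f g x. f x + g x"
  by (simp add: linear_iff algebra_simps)

lift_definition minus_gl :: "'a gl \<Rightarrow> 'a gl \<Rightarrow> 'a gl" is "\<lambda>f g x. f x - g x"
  by (simp add: linear_iff algebra_simps)

lift_definition uminus_gl :: "'a gl \<Rightarrow> 'a gl" is "\<lambda>f x. - f x"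
  by (simp add: linear_iff algebra_simps)

lift_definition scaleR_gl :: "real \<Rightarrow> 'a gl \<Rightarrow> 'a gl" is "\<lambda>c f x. c *\<^sub>R f x"
  by (simp add: linear_iff algebra_simps)

instance
  by standard (transfer, simp add: fun_eq_iff algebra_simps)+

end

lift_definition gl_id :: "'v::real_vector gl" is "\<lambda>x. x"
  by (simp add: linear_iff)

lift_definition gl_comp :: "'v::real_vector gl \<Rightarrow> 'v gl \<Rightarrow> 'v gl" is "\<lambda>f g x. f (g x)"
  by (simp add: linear_iff)

definition gl_commutator :: "'v::real_vector gl \<Rightarrow> 'v gl \<Rightarrow> 'v gl" where
  "gl_commutator A B = gl_comp A B - gl_comp B A"

type_synonym 'v omni_lie = "'v gl \<times> 'v"

definition omni_pairing :: "'v::real_vector omni_lie \<Rightarrow> 'v omni_lie \<Rightarrow> 'v" where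
  "omni_pairing = (\<lambda>(A, u) (B, v). (1 / 2) *\<^sub>R (gl_app A v + gl_app B u))"

definition omni_bracket ::
    "'v::real_vector omni_lie \<Rightarrow> 'v omni_lie \<Rightarrow> 'v omni_lie" where
  "omni_bracket = (\<lambda>(A, u) (B, v). (gl_commutator A B, gl_app A v))"

definition generalized_almost_complex ::
    "('v::real_vector omni_lie \<Rightarrow> 'v omni_lie) \<Rightarrow> bool" where
  "generalized_almost_complex J \<longleftrightarrow>
     linear J \<and>
     (\<forall>e. J (J e) = - e) \<and>
     (\<forall>e1 e2. omni_pairing (J e1) (J e2) = omni_pairing e1 e2)"

definition generalized_complex ::
    "('v::real_vector omni_lie \<Rightarrow> 'v omni_lie) \<Rightarrow> bool" where
  "generalized_complex J \<longleftrightarrow>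
     generalized_almost_complex J \<and>
     (\<forall>e1 e2. omni_bracket (J e1) (J e2) - omni_bracket e1 e2
        - J (omni_bracket (J e1) e2 + omni_bracket e1 (J e2)) = 0)"

text \<open>Elements of Hom(\<open>\<Lambda>\<^sup>2\<close>V, V) are represented as curried alternating bilinear maps.\<close>

definition alternating_bilinear :: "('v::real_vector \<Rightarrow> 'v \<Rightarrow> 'v) \<Rightarrow> bool" where
  "alternating_bilinear p \<longleftrightarrow> bilinear p \<and> (\<forall>u. p u u = 0)"

definition lie_algebra_structure :: "('v::real_vector \<Rightarrow> 'v \<Rightarrow> 'v) \<Rightarrow> bool" where
  "lie_algebra_structure br \<longleftrightarrow>
     alternating_bilinear br \<and>
     (\<forall>u v w. br u (br v w) + br v (br w u) + br w (br u v) = 0)"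

definition complex_lie_algebra_structure ::
    "('v::real_vector \<Rightarrow> 'v \<Rightarrow> 'v) \<Rightarrow> 'v gl \<Rightarrow> bool" where
  "complex_lie_algebra_structure br D \<longleftrightarrow>
     lie_algebra_structure br \<and>
     gl_comp D D = - gl_id \<and>
     (\<forall>u v. gl_app D (br u v) = br u (gl_app D v))"

text \<open>\<open>Abs_gl (p u)\<close> is unspecified unless \<open>p u\<close> is linear, so \<open>sharp\<close> is meaningful only
  for maps that are linear in the second argument.\<close>

definition sharp :: "('v::real_vector \<Rightarrow> 'v \<Rightarrow> 'v) \<Rightarrow> 'v \<Rightarrow> 'v gl" where
  "sharp p u = Abs_gl (p u)"

lemma gl_app_sharp: "alternating_bilinear p \<Longrightarrow> gl_app (sharp p u) v = p u v"
  by (simp add: sharp_def alternating_bilinear_def bilinear_def Abs_gl_inverse)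

definition omni_matrix ::
    "('v::real_vector \<Rightarrow> 'v \<Rightarrow> 'v) \<Rightarrow> 'v gl \<Rightarrow> 'v omni_lie \<Rightarrow> 'v omni_lie" where
  "omni_matrix p D = (\<lambda>(A, u). (- gl_comp A D + sharp p u, gl_app D u))"

end

theory Submission
  imports Defs
begin

text \<open>
  Two facts carry the result.

  The pairing alone forces the matrix shape. A generalized almost complex structure \<open>K\<close> is
  skew for the pairing, since it is orthogonal and \<open>K\<^sup>2 = -1\<close>. Skewness on two endomorphisms
  \<open>A\<close>, \<open>B\<close> reads \<open>B (\<gamma> A) + A (\<gamma> B) = 0\<close>, where \<open>\<gamma>\<close> is the \<open>V\<close>-component of \<open>K\<close> on \<open>gl(V)\<close>;
  the identity endomorphism is available for \<open>A\<close> and \<open>B\<close>, and this kills \<open>\<gamma>\<close>. Skewness on an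
  endomorphism and a vector then gives \<open>K A = - A \<circ> D\<close>, and skewness on two vectors
  says that the remaining block is \<open>\<pi>\<^sup>\<sharp>\<close> for an alternating \<open>\<pi>\<close>
  (\<open>generalized_almost_complex_is_omni_matrix\<close>).

  For such a matrix the integrability tensor can be written down in closed form
  (\<open>torsion_omni_matrix\<close>). It is built from two expressions only: the failure
  \<open>\<pi>(u, D v) - D \<pi>(u, v)\<close> of \<open>D\<close> to commute with the maps \<open>\<pi>\<^sup>\<sharp> u\<close>, and the Jacobiator of \<open>\<pi>\<close>. The first is
  the \<open>V\<close>-component, and once it vanishes the \<open>gl(V)\<close>-component is exactly the Jacobiator. Hence
  the tensor vanishes precisely when \<open>(V, \<pi>, D)\<close> is a complex Lie algebra.
\<close>

section \<open>Endomorphisms as functions\<close>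

lemma gl_eqI: "(\<And>x. gl_app A x = gl_app B x) \<Longrightarrow> A = B"
  by transfer auto

lemma linear_gl_app: "linear (gl_app A)"
  using gl_app[of A] by simp

lemmas gl_app_linear_simps =
  linear_add[OF linear_gl_app] linear_diff[OF linear_gl_app]
  linear_neg[OF linear_gl_app] linear_0[OF linear_gl_app]

lemmas gl_app_ops =
  zero_gl.rep_eq plus_gl.rep_eq minus_gl.rep_eq uminus_gl.rep_eq scaleR_gl.rep_eq
  gl_id.rep_eq gl_comp.rep_eq

lemma gl_app_commutator:
  "gl_app (gl_commutator A B) x = gl_app A (gl_app B x) - gl_app B (gl_app A x)"
  by (simp add: gl_commutator_def gl_app_ops)

lemma gl_comp_self_eq_minus_id_iff:
  "gl_comp D D = - gl_id \<longleftrightarrow> (\<forall>x. gl_app D (gl_app D x) = - x)"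
proof
  assume "gl_comp D D = - gl_id"
  then have "gl_app (gl_comp D D) x = gl_app (- gl_id) x" for x by simp
  then show "\<forall>x. gl_app D (gl_app D x) = - x" by (simp add: gl_app_ops)
qed (auto intro: gl_eqI simp: gl_app_ops)

section \<open>The integrability tensor of a matrix structure\<close>

definition torsion ::
    "('v::real_vector omni_lie \<Rightarrow> 'v omni_lie) \<Rightarrow> 'v omni_lie \<Rightarrow> 'v omni_lie \<Rightarrow> 'v omni_lie" where
  "torsion J e1 e2 = omni_bracket (J e1) (J e2) - omni_bracket e1 e2
     - J (omni_bracket (J e1) e2 + omni_bracket e1 (J e2))"

lemma generalized_complex_iff_torsion:
  "generalized_complex J \<longleftrightarrow> generalized_almost_complex J \<and> (\<forall>e1 e2. torsion J e1 e2 = 0)"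
  by (simp add: generalized_complex_def torsion_def)

lemma alternating_bilinear_antisym:
  assumes "alternating_bilinear p"
  shows "p v u = - p u v"
proof -
  have b: "bilinear p" and z: "\<And>x. p x x = 0"
    using assms by (auto simp: alternating_bilinear_def)
  have "p (u + v) (u + v) = p u u + p u v + (p v u + p v v)"
    by (simp only: bilinear_ladd[OF b] bilinear_radd[OF b] ac_simps)
  then have "p u v + p v u = 0"
    by (simp add: z)
  then show ?thesis
    by (simp add: eq_neg_iff_add_eq_0 add.commute)
qed

text \<open>
  The bracket terms that mix both endomorphisms cancel because \<open>D\<^sup>2 = -1\<close>. The
  endomorphisms \<open>A\<close> and \<open>B\<close> survive only as left multipliers of the defect
  \<open>\<pi>(x, D w) - D \<pi>(x, w)\<close>, and the terms without \<open>A\<close> and \<open>B\<close> form the Jacobiator.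
\<close>

lemma torsion_omni_matrix:
  assumes alt: "alternating_bilinear p" and D2: "gl_comp D D = - gl_id"
  shows "gl_app (fst (torsion (omni_matrix p D) (A, u) (B, v))) w =
      gl_app A (p v (gl_app D w) - gl_app D (p v w))
      - gl_app B (p u (gl_app D w) - gl_app D (p u w))
      + (p u (p v w) - p v (p u w) - p (p u v) w)" (is ?fst)
    and "snd (torsion (omni_matrix p D) (A, u) (B, v)) =
      p u (gl_app D v) - gl_app D (p u v)" (is ?snd)
proof -
  have b: "bilinear p" using alt by (simp add: alternating_bilinear_def)
  have D2': "\<And>x. gl_app D (gl_app D x) = - x"
    using D2 by (simp add: gl_comp_self_eq_minus_id_iff)
  note simps = torsion_def omni_matrix_def omni_bracket_def gl_app_commutator gl_app_ops
    gl_app_linear_simps gl_app_sharp[OF alt] D2'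
    bilinear_radd[OF b] bilinear_rsub[OF b] bilinear_rneg[OF b]
    bilinear_ladd[OF b] bilinear_lsub[OF b] bilinear_lneg[OF b]
    bilinear_rzero[OF b] bilinear_lzero[OF b]
  show ?fst by (simp add: simps)
  show ?snd by (simp add: simps)
qed

theorem omni_matrix_integrable_iff:
  assumes alt: "alternating_bilinear p" and D2: "gl_comp D D = - gl_id"
  shows "(\<forall>e1 e2. torsion (omni_matrix p D) e1 e2 = 0) \<longleftrightarrow> complex_lie_algebra_structure p D"
proof -
  have b: "bilinear p" using alt by (simp add: alternating_bilinear_def)
  note T = torsion_omni_matrix[OF alt D2]
  \<comment> \<open>Antisymmetry turns the cyclic Jacobi identity into the derivation form of the torsion.\<close>
  have jac: "p u (p v w) + p v (p w u) + p w (p u v) = p u (p v w) - p v (p u w) - p (p u v) w"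
    for u v w
    using alternating_bilinear_antisym[OF alt, of w u]
      alternating_bilinear_antisym[OF alt, of w "p u v"]
    by (simp add: bilinear_rneg[OF b])
  show ?thesis
  proof
    assume zero: "\<forall>e1 e2. torsion (omni_matrix p D) e1 e2 = 0"
    have comm: "gl_app D (p u v) = p u (gl_app D v)" for u v
      using T(2)[of 0 u 0 v] zero by simp
    have "p u (p v w) - p v (p u w) - p (p u v) w = 0" for u v w
      using T(1)[of 0 u 0 v w] zero by (simp add: gl_app_ops)
    then show "complex_lie_algebra_structure p D"
      using alt D2 comm jac
      by (simp add: complex_lie_algebra_structure_def lie_algebra_structure_def)
  next
    assume "complex_lie_algebra_structure p D"
    then have comm: "\<And>u v. gl_app D (p u v) = p u (gl_app D v)"
      and lie: "\<And>u v w. p u (p v w) - p v (p u w) - p (p u v) w = 0"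
      using jac by (auto simp: complex_lie_algebra_structure_def lie_algebra_structure_def)
    have "torsion (omni_matrix p D) (A, u) (B, v) = 0" for A u B v
    proof (rule prod_eqI)
      show "fst (torsion (omni_matrix p D) (A, u) (B, v)) = fst 0"
        by (rule gl_eqI) (simp add: T(1) comm lie gl_app_ops gl_app_linear_simps)
      show "snd (torsion (omni_matrix p D) (A, u) (B, v)) = snd 0"
        by (simp add: T(2) comm)
    qed
    then show "\<forall>e1 e2. torsion (omni_matrix p D) e1 e2 = 0"
      by (metis surj_pair)
  qed
qed

section \<open>Every generalized almost complex structure is a matrix structure\<close>

lemma generalized_almost_complex_skew:
  assumes "generalized_almost_complex K"
  shows "omni_pairing (K e1) e2 = - omni_pairing e1 (K e2)"
proof -
  have "omni_pairing (K e1) e2 = omni_pairing (K (K e1)) (K e2)"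
    using assms unfolding generalized_almost_complex_def by metis
  also have "\<dots> = omni_pairing (- e1) (K e2)"
    using assms unfolding generalized_almost_complex_def by metis
  also have "\<dots> = - omni_pairing e1 (K e2)"
    by (cases e1; cases "K e2")
      (simp add: omni_pairing_def gl_app_ops gl_app_linear_simps algebra_simps)
  finally show ?thesis .
qed

lemma omni_pairing_skew_iff:
  "omni_pairing (A, u) (B, v) = - omni_pairing (A', u') (B', v') \<longleftrightarrow>
    gl_app A v + gl_app B u = - (gl_app A' v' + gl_app B' u')"
  unfolding omni_pairing_def prod.case scaleR_minus_right[symmetric]
  by (subst scaleR_cancel_left) simp

theorem generalized_almost_complex_is_omni_matrix:
  assumes K: "generalized_almost_complex (K :: 'v::real_vector omni_lie \<Rightarrow> 'v omni_lie)"
  obtains p D where "alternating_bilinear p" "gl_comp D D = - gl_id" "K = omni_matrix p D"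
proof -
  have lin: "linear K" and sq: "\<And>e. K (K e) = - e"
    using K by (auto simp: generalized_almost_complex_def)
  have skew: "gl_app (fst (K (A, u))) v + gl_app B (snd (K (A, u))) =
      - (gl_app A (snd (K (B, v))) + gl_app (fst (K (B, v))) u)" for A B u v
    using generalized_almost_complex_skew[OF K, of "(A, u)" "(B, v)"]
      omni_pairing_skew_iff[of "fst (K (A, u))" "snd (K (A, u))" B v A u
        "fst (K (B, v))" "snd (K (B, v))"]
    by simp
  define p where "p u v = gl_app (fst (K (0, u))) v" for u v
  define D where "D = Abs_gl (\<lambda>u. snd (K (0, u)))"

  have "linear (\<lambda>u. snd (K (0, u)))"
    by (rule linearI)
      (use linear_add[OF lin, of "(0, _)" "(0, _)"] linear_scale[OF lin, of _ "(0, _)"]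
        in \<open>simp_all flip: snd_add snd_scaleR\<close>)
  then have D: "gl_app D u = snd (K (0, u))" for u
    by (simp add: D_def Abs_gl_inverse)
  have "linear (\<lambda>u. p u v)" for v
  proof (rule linearI)
    show "p (x + y) v = p x v + p y v" for x y
      using linear_add[OF lin, of "(0, x)" "(0, y)"] by (simp add: p_def gl_app_ops)
    show "p (c *\<^sub>R x) v = c *\<^sub>R p x v" for c x
      using linear_scale[OF lin, of c "(0, x)"] by (simp add: p_def gl_app_ops)
  qed
  moreover have "linear (p u)" for u
    unfolding p_def by (rule linear_gl_app)
  moreover have "p u u = 0" for u
  proof -
    have "p u u = - p u u"
      using skew[of 0 u u 0] by (simp add: p_def gl_app_ops)
    then have "2 *\<^sub>R p u u = 0"
      by (metis add.left_inverse scaleR_2)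
    then show ?thesis by simp
  qed
  ultimately have alt: "alternating_bilinear p"
    by (simp add: alternating_bilinear_def bilinear_def)

  \<comment> \<open>Pairing the identity with itself gives \<open>K (gl_id, 0)\<close> no \<open>V\<close>-component; pairing any
    \<open>A\<close> with the identity transfers this to \<open>A\<close>.\<close>
  have "snd (K (gl_id, 0)) = - snd (K (gl_id, 0))"
    using skew[of gl_id 0 0 gl_id] by (simp add: gl_app_ops gl_app_linear_simps)
  then have "2 *\<^sub>R snd (K (gl_id, 0)) = 0"
    by (metis add.left_inverse scaleR_2)
  then have snd_id: "snd (K (gl_id, 0)) = 0" by simp
  have snd_gl: "snd (K (A, 0)) = 0" for A
    using skew[of A 0 0 gl_id] by (simp add: snd_id gl_app_ops gl_app_linear_simps)
  have fst_gl: "fst (K (A, 0)) = - gl_comp A D" for A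
    using skew[of A 0 _ 0]
    by (intro gl_eqI) (simp add: D gl_app_ops gl_app_linear_simps)
  have "K (A, u) = omni_matrix p D (A, u)" for A u
  proof -
    have "K (A, u) = K (A, 0) + K (0, u)"
      using linear_add[OF lin, of "(A, 0)" "(0, u)"] by simp
    moreover have "sharp p u = fst (K (0, u))"
      by (rule gl_eqI) (simp add: gl_app_sharp[OF alt] p_def)
    ultimately show ?thesis
      by (simp add: omni_matrix_def prod_eq_iff fst_gl snd_gl D)
  qed
  then have mat: "K = omni_matrix p D" by auto
  have "gl_app D (gl_app D u) = - u" for u
    using sq[of "(0, u)"] by (simp add: mat omni_matrix_def)
  then have "gl_comp D D = - gl_id"
    by (simp add: gl_comp_self_eq_minus_id_iff)
  with alt mat show thesis by (intro that)
qed

section \<open>Generalized complex structures and complex Lie algebras\<close>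

theorem theorem6p4:
  assumes findim: "\<exists>B. finite B \<and> span B = (UNIV :: 'v::real_vector set)"
  shows
    "(\<forall>(\<pi> :: 'v \<Rightarrow> 'v \<Rightarrow> 'v) (D :: 'v gl).
        alternating_bilinear \<pi> \<longrightarrow>
        gl_comp D D = - gl_id \<longrightarrow>
        (\<forall>u v. \<pi> (gl_app D u) v = \<pi> u (gl_app D v)) \<longrightarrow>
        generalized_almost_complex (omni_matrix \<pi> D) \<longrightarrow>
        (generalized_complex (omni_matrix \<pi> D) \<longleftrightarrow>
           lie_algebra_structure \<pi> \<and>
           (gl_comp D D = - gl_id \<and>
            (\<forall>u v. gl_app D (\<pi> u v) = \<pi> u (gl_app D v)))) \<and>
        (generalized_complex (omni_matrix \<pi> D) \<longrightarrow>
           complex_lie_algebra_structure \<pi> D)) \<and>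
     (\<forall>K :: 'v omni_lie \<Rightarrow> 'v omni_lie.
        generalized_complex K \<longrightarrow>
        (\<exists>\<pi> D. alternating_bilinear \<pi> \<and> K = omni_matrix \<pi> D \<and>
               complex_lie_algebra_structure \<pi> D))"
proof (intro conjI allI impI)
  fix \<pi> :: "'v \<Rightarrow> 'v \<Rightarrow> 'v" and D :: "'v gl"
  assume "alternating_bilinear \<pi>" "gl_comp D D = - gl_id"
    and "generalized_almost_complex (omni_matrix \<pi> D)"
  then have iff: "generalized_complex (omni_matrix \<pi> D) \<longleftrightarrow> complex_lie_algebra_structure \<pi> D"
    using omni_matrix_integrable_iff[of \<pi> D] unfolding generalized_complex_iff_torsion by blast
  then show "generalized_complex (omni_matrix \<pi> D) \<longleftrightarrow>
      lie_algebra_structure \<pi> \<and>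
      (gl_comp D D = - gl_id \<and> (\<forall>u v. gl_app D (\<pi> u v) = \<pi> u (gl_app D v)))"
    by (simp add: complex_lie_algebra_structure_def)
  show "complex_lie_algebra_structure \<pi> D" if "generalized_complex (omni_matrix \<pi> D)"
    using that iff by simp
next
  fix K :: "'v omni_lie \<Rightarrow> 'v omni_lie"
  assume K: "generalized_complex K"
  then obtain p D where "alternating_bilinear p" "gl_comp D D = - gl_id" "K = omni_matrix p D"
    using generalized_almost_complex_is_omni_matrix
    by (auto simp: generalized_complex_def)
  with K show "\<exists>\<pi> D. alternating_bilinear \<pi> \<and> K = omni_matrix \<pi> D \<and>
      complex_lie_algebra_structure \<pi> D"
    using omni_matrix_integrable_iff[of p D] by (auto simp: generalized_complex_iff_torsion)
qed

end
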